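(* Let $p\ge 5$ be a prime and let $r$ be a nonzero integer relatively prime to $p$. If $m\in T^*(p,r,0)$, then for all integers $n\ge 0$, $$\xi_r(pn+m)\equiv 0\pmod p .$$
   Context: For $n\ge 0$ let $(q;q)_n=\prod_{i=1}^n(1-q^i)$ (with $(q;q)_0=1$), and let $F(q)=\sum_{n=0}^\infty (q;q)_n$. For a nonzero integer $r$, the $r$-Fishburn numbers $\xi_r(n)\in\mathbb{Z}$ ($n\ge 0$) are defined by the formal power series identity $$\sum_{n=0}^\infty \xi_r(n)q^n = F((1-q)^r)=\sum_{n=0}^\infty\prod_{i=1}^n\left(1-(1-q)^{ri}\right),$$ where $(1-q)^{ri}$ is expanded as a formal power series in $q$ (the $n$-th summand is divisible by $q^n$, so the sum is well defined in $\mathbb{Z}[[q]]$). For a prime $p\ge5$, a nonzero integer $r$ relatively prime to $p$, and an integer $0\le s\le p-1$, define $$S^*(p,r,s)=\left\{ j : 0\le j\le p-1,\ \tfrac12 r n(3n-1)\equiv j-s \pmod p \text{ for some integer } n,\ \text{and } 24(j-s)\not\equiv -r \pmod p\right\},$$ $$T^*(p,r,s)=\left\{ k : 0\le k\le p-1 \text{ such that } k \text{ is larger than every element of } S^*(p,r,s)\right\},$$ where $j$ and $k$ range over integers. *)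

theory Defs
  imports
    "HOL-Computational_Algebra.Computational_Algebra"
    "HOL-Number_Theory.Number_Theory"
begin

text \<open>
  The binomial expansion of \<open>(1 - q)\<^sup>a\<close> in \<open>\<int>[[q]]\<close> for an integer exponent \<open>a\<close>. The library's
  integer power of formal power series needs coefficients in a field, so for negative \<open>a\<close> the
  inverse of \<open>1 - q\<close> over the integers, the geometric series, is written out.
\<close>

definition one_minus_X_powi :: "int \<Rightarrow> int fps" where
  "one_minus_X_powi a =
     (if a \<ge> 0 then (1 - fps_X) ^ nat a else Abs_fps (\<lambda>_. 1) ^ nat (- a))"

lemma geometric_series_inverse: "(1 - fps_X) * Abs_fps (\<lambda>_. 1) = (1 :: int fps)"
  by (rule fps_ext) (simp add: left_diff_distrib)

lemma one_minus_X_powi_inverse: "one_minus_X_powi a * one_minus_X_powi (- a) = 1"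
  using geometric_series_inverse
  by (auto simp: one_minus_X_powi_def mult.commute simp flip: power_mult_distrib)

lemma one_minus_X_powi_nth_0: "fps_nth (one_minus_X_powi a) 0 = 1"
  by (simp add: one_minus_X_powi_def fps_power_zeroth)


definition fishburn_summand :: "int \<Rightarrow> nat \<Rightarrow> int fps" where
  "fishburn_summand r n = (\<Prod>i=1..n. 1 - one_minus_X_powi (r * int i))"

text \<open>
  The series \<open>F((1 - q)\<^sup>r)\<close>. The infinite sum is taken in the \<open>q\<close>-adic topology of the type of
  formal power series; it converges by \<open>fishburn_summand_sums\<close> below.
\<close>

definition fishburn_fps :: "int \<Rightarrow> int fps" where
  "fishburn_fps r = (\<Sum>n. fishburn_summand r n)"

definition fishburn :: "int \<Rightarrow> nat \<Rightarrow> int" where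
  "fishburn r n = fps_nth (fishburn_fps r) n"

lemma fishburn_summand_nth_less: "k < n \<Longrightarrow> fps_nth (fishburn_summand r n) k = 0"
proof (induction n arbitrary: k)
  case 0
  then show ?case by simp
next
  case (Suc n)
  define g where "g = 1 - one_minus_X_powi (r * int (Suc n))"
  have g0: "fps_nth g 0 = 0"
    by (simp add: g_def one_minus_X_powi_nth_0)
  have "fishburn_summand r (Suc n) = fishburn_summand r n * g"
    by (simp add: fishburn_summand_def g_def)
  moreover have "fps_nth (fishburn_summand r n) i * fps_nth g (k - i) = 0" if "i \<le> k" for i
  proof (cases "i < n")
    case True
    then show ?thesis using Suc.IH by simp
  next
    case False
    then have "k - i = 0" using Suc.prems that by simp
    then show ?thesis using g0 by simp
  qed
  ultimately show ?case by (auto simp only: fps_mult_nth atLeastAtMost_iff intro!: sum.neutral)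
qed

lemma fishburn_summand_sums:
  "fishburn_summand r sums Abs_fps (\<lambda>k. \<Sum>n\<le>k. fps_nth (fishburn_summand r n) k)"
  unfolding sums_def
proof (rule tendsto_fpsI)
  fix k
  show "\<forall>\<^sub>F N in sequentially. fps_nth (\<Sum>n<N. fishburn_summand r n) k =
      fps_nth (Abs_fps (\<lambda>k. \<Sum>n\<le>k. fps_nth (fishburn_summand r n) k)) k"
    using eventually_gt_at_top[of k]
  proof eventually_elim
    case (elim N)
    have "(\<Sum>n<N. fps_nth (fishburn_summand r n) k) = (\<Sum>n\<le>k. fps_nth (fishburn_summand r n) k)"
      using elim by (intro sum.mono_neutral_right) (auto intro: fishburn_summand_nth_less)
    then show ?case by (simp add: fps_sum_nth)
  qed
qed

lemma fishburn_altdef: "fishburn r k = (\<Sum>n\<le>k. fps_nth (fishburn_summand r n) k)"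
  using sums_unique[OF fishburn_summand_sums[of r], symmetric]
  by (simp add: fishburn_def fishburn_fps_def)


text \<open>The division by 2 is exact, since \<open>n * (3 * n - 1)\<close> is always even.\<close>

definition S_star :: "nat \<Rightarrow> int \<Rightarrow> int \<Rightarrow> int set" where
  "S_star p r s =
     {j. 0 \<le> j \<and> j \<le> int p - 1 \<and>
         (\<exists>n::int. [r * (n * (3 * n - 1)) div 2 = j - s] (mod int p)) \<and>
         \<not> [24 * (j - s) = - r] (mod int p)}"

definition T_star :: "nat \<Rightarrow> int \<Rightarrow> int \<Rightarrow> int set" where
  "T_star p r s = {k. 0 \<le> k \<and> k \<le> int p - 1 \<and> (\<forall>j \<in> S_star p r s. j < k)}"

end

theory Submission
  imports Defs
begin

text \<open>
  Put \<open>Q = (1 - X)\<^sup>r\<close> and \<open>F = (\<Sum>n. (Q; Q)\<^sub>n)\<close>. Zagier's ``strange identity'' writes \<open>F\<close>, up to a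
  constant factor, as the divergent sum of \<open>\<plusminus> a * Q ^ e\<close> over the pentagonal numbers \<open>e\<close>, where
  \<open>a\<^sup>2 = 24 * e + 1\<close>. The theorem is true because this identity becomes an honest congruence between
  finite sums modulo \<open>p\<close> and a power of \<open>X\<close> (lemma \<open>strange_identity_derivative\<close>). A term of
  it whose coefficient \<open>a\<close> is not divisible by \<open>p\<close> has \<open>24 * e + 1\<close> prime to \<open>p\<close>, so the residue
  \<open>j\<close> of \<open>r * e\<close> lies in \<open>S\<^sup>*(p, r, 0)\<close>. Since \<open>Q ^ e = (1 - X) ^ j * g ^ p\<close> for a series \<open>g\<close>, and
  \<open>g ^ p\<close> is a series in \<open>X ^ p\<close> modulo \<open>p\<close>, the exponents occurring in \<open>Q ^ e\<close> modulo \<open>p\<close> are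
  congruent to \<open>0, \<dots>, j\<close>, hence never to an \<open>m\<close> with \<open>j < m < p\<close> (lemmas
  \<open>prime_dvd_nth_one_minus_X_powi\<close> and \<open>prime_dvd_pentagonal_term\<close>).

  For the congruence, Zagier's series \<open>S(x) = (\<Sum>n. (x; q)\<^sub>n\<^sub>+\<^sub>1 x\<^sup>n)\<close> satisfies
  \<open>S(x) = 1 - q x\<^sup>2 - q\<^sup>2 x\<^sup>3 S(q x)\<close>. Applying this \<open>K\<close> times relates \<open>S(x)\<close> to
  \<open>(-1) ^ K * S(q ^ K * x)\<close> with a partial theta sum as the difference. If \<open>K\<close> is a large power of
  \<open>p\<close>, then \<open>Q ^ K\<close> is congruent to \<open>1\<close>, and as \<open>K\<close> is odd, the two occurrences of \<open>S\<close> add up to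
  \<open>2 * S(x)\<close>, which is thus congruent to a finite sum. Since \<open>S(1) = 0\<close> and \<open>S'(1) = - F\<close>, the
  derivative at \<open>x = 1\<close> gives the coefficients \<open>3 k\<close> and \<open>3 k + 2\<close> for the exponents
  \<open>k (3 k + 1) / 2\<close> and \<open>(k + 1) (3 k + 2) / 2\<close>; adding half of the value at \<open>x = 1\<close>, which is
  congruent to \<open>0\<close>, turns them into \<open>(6 k + 1) / 2\<close> and \<open>(6 k + 5) / 2\<close>, whose numerators are the
  square roots of \<open>24 * e + 1\<close> for these exponents \<open>e\<close>.
\<close>

section \<open>Congruences modulo an ideal\<close>

locale ring_ideal =
  fixes I :: "'a :: comm_ring_1 set"
  assumes zero_mem: "0 \<in> I"
    and add_mem: "a \<in> I \<Longrightarrow> b \<in> I \<Longrightarrow> a + b \<in> I"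
    and mult_mem: "a \<in> I \<Longrightarrow> c * a \<in> I"
begin

definition congr :: "'a \<Rightarrow> 'a \<Rightarrow> bool"  (infix "\<approx>" 50)
  where "a \<approx> b \<longleftrightarrow> a - b \<in> I"

lemma congr_refl [simp, intro]: "a \<approx> a"
  by (simp add: congr_def zero_mem)

lemma congr_0_iff: "a \<approx> 0 \<longleftrightarrow> a \<in> I"
  by (simp add: congr_def)

lemma congr_trans [trans]: "a \<approx> b \<Longrightarrow> b \<approx> c \<Longrightarrow> a \<approx> c"
  using add_mem[of "a - b" "b - c"] by (simp add: congr_def)

lemma congr_minus: "a \<approx> b \<Longrightarrow> - a \<approx> - b"
  using mult_mem[of "a - b" "- 1"] by (simp add: congr_def)

lemma congr_sym: "a \<approx> b \<Longrightarrow> b \<approx> a"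
  using mult_mem[of "a - b" "- 1"] by (simp add: congr_def)

lemma congr_add: "a \<approx> b \<Longrightarrow> c \<approx> d \<Longrightarrow> a + c \<approx> b + d"
  using add_mem[of "a - b" "c - d"] by (simp add: congr_def algebra_simps)

lemma congr_diff: "a \<approx> b \<Longrightarrow> c \<approx> d \<Longrightarrow> a - c \<approx> b - d"
  using congr_add[of a b "- c" "- d"] congr_minus by simp

lemma congr_mult:
  assumes "a \<approx> b" "c \<approx> d"
  shows "a * c \<approx> b * d"
proof -
  have "a * c - b * d = c * (a - b) + b * (c - d)"
    by (simp add: algebra_simps)
  then show ?thesis
    using assms by (simp add: congr_def add_mem mult_mem)
qed

lemma congr_power: "a \<approx> b \<Longrightarrow> a ^ n \<approx> b ^ n"
  by (induction n) (auto intro: congr_mult)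

lemma congr_sum: "(\<And>i. i \<in> A \<Longrightarrow> f i \<approx> g i) \<Longrightarrow> sum f A \<approx> sum g A"
  by (induction A rule: infinite_finite_induct) (auto intro: congr_add)

lemma congr_prod: "(\<And>i. i \<in> A \<Longrightarrow> f i \<approx> g i) \<Longrightarrow> prod f A \<approx> prod g A"
  by (induction A rule: infinite_finite_induct) (auto intro: congr_mult)

end


section \<open>The strange identity modulo an ideal\<close>

definition qpoch :: "'a :: comm_ring_1 \<Rightarrow> 'a \<Rightarrow> nat \<Rightarrow> 'a" where
  "qpoch x q n = (\<Prod>i<n. 1 - x * q ^ i)"

definition zagier_sum :: "nat \<Rightarrow> 'a :: comm_ring_1 \<Rightarrow> 'a \<Rightarrow> 'a" where
  "zagier_sum N q x = (\<Sum>n<N. qpoch x q (Suc n) * x ^ n)"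

lemma qpoch_Suc_left: "qpoch x q (Suc n) = (1 - x) * qpoch (q * x) q n"
  unfolding qpoch_def
  by (subst prod.lessThan_Suc_shift) (simp add: algebra_simps)

lemma qpoch_Suc_right: "qpoch x q (Suc n) = qpoch x q n * (1 - x * q ^ n)"
  by (simp add: qpoch_def)

text \<open>
  For the infinite series, \<open>(x; q)\<^sub>n\<^sub>+\<^sub>1 = (1 - x) * (q x; q)\<^sub>n\<close> and summation by parts against
  \<open>(1 - x) * x\<^sup>n\<close> turn \<open>S(x)\<close> into \<open>1 - (\<Sum>n\<ge>1. q\<^sup>n x\<^sup>n\<^sup>+\<^sup>1 (q x; q)\<^sub>n\<^sub>-\<^sub>1)\<close>, where the terms from
  \<open>n = 2\<close> on form \<open>q\<^sup>2 x\<^sup>3 S(q x)\<close>. This shift of the index is why the two lengths differ by 2;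
  the last term is the boundary term of the truncated summation by parts.
\<close>

lemma zagier_sum_functional_equation:
  "zagier_sum (N + 2) q x =
     1 - q * x\<^sup>2 - q\<^sup>2 * x ^ 3 * zagier_sum N q (q * x) - x ^ (N + 2) * qpoch (q * x) q (Suc N)"
proof (induction N)
  case 0
  show ?case
    by (simp add: zagier_sum_def qpoch_def numeral_2_eq_2 power3_eq_cube algebra_simps)
next
  case (Suc N)
  define P where "P = qpoch (q * x) q (Suc N)"
  have l: "zagier_sum (Suc N + 2) q x = zagier_sum (N + 2) q x + qpoch x q (Suc (Suc (Suc N))) * x ^ (N + 2)"
    by (simp add: zagier_sum_def)
  have r: "zagier_sum (Suc N) q (q * x) = zagier_sum N q (q * x) + P * (q * x) ^ N"
    by (simp add: zagier_sum_def P_def)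
  have P': "qpoch (q * x) q (Suc (Suc N)) = P * (1 - q * x * q ^ Suc N)"
    by (simp add: P_def qpoch_Suc_right)
  have x3: "qpoch x q (Suc (Suc (Suc N))) = (1 - x) * (P * (1 - q * x * q ^ Suc N))"
    by (subst qpoch_Suc_left) (simp only: P')
  show ?case
    unfolding l r Suc.IH x3 unfolding P' P_def[symmetric]
    by (simp add: power_mult_distrib power2_eq_square power3_eq_cube algebra_simps)
qed

text \<open>
  These are the values of \<open>n (3 n - 1) / 2\<close> at \<open>n = - k\<close>. The values at \<open>n = k + 1\<close> are
  \<open>pentagonal k + 2 * k + 1\<close>, and together the two families are all generalised pentagonal numbers.
\<close>

abbreviation pentagonal :: "nat \<Rightarrow> nat" where
  "pentagonal k \<equiv> k * (3 * k + 1) div 2"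

lemma two_pentagonal: "2 * pentagonal k = k * (3 * k + 1)"
  by (intro dvd_mult_div_cancel) auto

lemma pentagonal_int:
  "2 * int (pentagonal k) = (- int k) * (3 * (- int k) - 1)"
  "24 * int (pentagonal k) + 1 = (6 * int k + 1)\<^sup>2"
  "2 * int (pentagonal k + 2 * k + 1) = (int k + 1) * (3 * (int k + 1) - 1)"
  "24 * int (pentagonal k + 2 * k + 1) + 1 = (6 * int k + 5)\<^sup>2"
proof -
  define E where "E = pentagonal k"
  have "2 * int E = int k * (3 * int k + 1)"
    using arg_cong[OF two_pentagonal[of k], of int]
    by (simp only: E_def of_nat_mult of_nat_add of_nat_numeral of_nat_1)
  then show
    "2 * int (pentagonal k) = (- int k) * (3 * (- int k) - 1)"
    "24 * int (pentagonal k) + 1 = (6 * int k + 1)\<^sup>2"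
    "2 * int (pentagonal k + 2 * k + 1) = (int k + 1) * (3 * (int k + 1) - 1)"
    "24 * int (pentagonal k + 2 * k + 1) + 1 = (6 * int k + 5)\<^sup>2"
    unfolding E_def[symmetric] by (simp_all add: power2_eq_square algebra_simps)
qed

lemma pentagonal_Suc: "pentagonal (Suc k) = pentagonal k + (3 * k + 2)"
  using two_pentagonal[of k] two_pentagonal[of "Suc k"] by (simp add: algebra_simps)

text \<open>
  The first assumption makes \<open>zagier_sum N q (q ^ k * x)\<close> stationary from \<open>N = M\<close> on, so that
  the truncated functional equation closes up on sums of the single length \<open>M\<close>. After \<open>K\<close>
  applications it returns to the initial argument, with the factor \<open>(-1) ^ K = - 1\<close>.
\<close>

lemma (in ring_ideal) strange_identity:
  assumes small: "\<And>k. qpoch (q ^ k * x) q M \<in> I"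
    and q: "q ^ K \<approx> 1" and x: "x ^ K \<approx> 1" and "odd K"
  shows "2 * zagier_sum M q x \<approx>
    (\<Sum>k<K. (- 1) ^ k * q ^ pentagonal k * x ^ (3 * k) * (1 - q ^ (2 * k + 1) * x\<^sup>2))"
proof -
  define T where "T k = zagier_sum M q (q ^ k * x)" for k
  have small': "qpoch (q ^ k * x) q (M + d) \<in> I" for k d
    by (induction d) (auto simp: small qpoch_Suc_right mult.commute[of "qpoch _ _ _"] intro: mult_mem)
  have cut: "zagier_sum (M + d) q (q ^ k * x) \<approx> T k" for k d
  proof (induction d)
    case (Suc d)
    have "qpoch (q ^ k * x) q (M + Suc d) * (q ^ k * x) ^ (M + d) \<approx> 0"
      using small'[of k "Suc d"] by (simp only: congr_0_iff mult.commute[of "qpoch _ _ _"] mult_mem)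
    from congr_add[OF Suc this] show ?case by (simp add: zagier_sum_def)
  qed (simp add: T_def)
  have step: "T k \<approx> 1 - q ^ (2 * k + 1) * x\<^sup>2 - q ^ (3 * k + 2) * x ^ 3 * T (Suc k)" for k
  proof -
    have err: "(q ^ k * x) ^ (M + 2) * qpoch (q * (q ^ k * x)) q (Suc M) \<approx> 0"
      using small'[of "Suc k" 1] by (simp add: congr_0_iff mult_mem mult.assoc)
    have "T k \<approx> zagier_sum (M + 2) q (q ^ k * x)"
      by (rule congr_sym[OF cut])
    also have "zagier_sum (M + 2) q (q ^ k * x) =
        1 - q ^ (2 * k + 1) * x\<^sup>2 - q ^ (3 * k + 2) * x ^ 3 * T (Suc k)
        - (q ^ k * x) ^ (M + 2) * qpoch (q * (q ^ k * x)) q (Suc M)"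
    proof -
      have "2 * k + 1 = k + k + 1" "3 * k + 2 = k + k + k + 2"
        by simp_all
      then have "q * (q ^ k * x)\<^sup>2 = q ^ (2 * k + 1) * x\<^sup>2"
        and "q\<^sup>2 * (q ^ k * x) ^ 3 = q ^ (3 * k + 2) * x ^ 3"
        and "q * (q ^ k * x) = q ^ Suc k * x"
        by (simp_all only: power_add power_Suc power_one_right power2_eq_square power3_eq_cube mult_ac)
      then show ?thesis
        by (simp only: zagier_sum_functional_equation T_def)
    qed
    also have "\<dots> \<approx> 1 - q ^ (2 * k + 1) * x\<^sup>2 - q ^ (3 * k + 2) * x ^ 3 * T (Suc k) - 0"
      by (intro congr_diff congr_refl err)
    finally show ?thesis by simp
  qed
  have iter: "T 0 \<approx> (\<Sum>k<K. (- 1) ^ k * q ^ pentagonal k * x ^ (3 * k) * (1 - q ^ (2 * k + 1) * x\<^sup>2))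
      + (- 1) ^ K * q ^ pentagonal K * x ^ (3 * K) * T K" for K
  proof (induction K)
    case (Suc K)
    let ?S = "\<Sum>k<K. (- 1) ^ k * q ^ pentagonal k * x ^ (3 * k) * (1 - q ^ (2 * k + 1) * x\<^sup>2)"
    let ?c = "(- 1) ^ K * q ^ pentagonal K * x ^ (3 * K)"
    note Suc
    also have "?S + ?c * T K \<approx>
        ?S + ?c * (1 - q ^ (2 * K + 1) * x\<^sup>2 - q ^ (3 * K + 2) * x ^ 3 * T (Suc K))"
      by (intro congr_add congr_mult congr_refl step)
    also have "\<dots> = (?S + ?c * (1 - q ^ (2 * K + 1) * x\<^sup>2))
        + (- 1) ^ Suc K * q ^ pentagonal (Suc K) * x ^ (3 * Suc K) * T (Suc K)"
      unfolding pentagonal_Suc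
      by (simp add: power_add algebra_simps power2_eq_square power3_eq_cube)
    finally show ?case by simp
  qed (simp add: T_def)
  have "q ^ pentagonal K \<approx> 1"
  proof -
    \<comment> \<open>Parity does more than fix a sign: for odd \<open>K\<close>, \<open>K\<close> divides its pentagonal number.\<close>
    have "pentagonal K = K * ((3 * K + 1) div 2)"
      using \<open>odd K\<close> by (intro div_mult_swap[symmetric]) auto
    then show ?thesis
      using congr_power[OF q, of "(3 * K + 1) div 2"] by (simp only: power_mult power_one)
  qed
  moreover have "x ^ (3 * K) \<approx> 1"
    using congr_power[OF x, of 3] by (simp add: power_mult mult.commute)
  moreover have "zagier_sum M q a \<approx> zagier_sum M q b" if "a \<approx> b" for a b
    unfolding zagier_sum_def qpoch_def
    by (intro congr_sum congr_mult congr_prod congr_diff congr_power congr_refl that)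
  then have "T K \<approx> T 0"
    using congr_mult[OF q congr_refl, of x] by (simp add: T_def)
  ultimately have "(- 1) ^ K * q ^ pentagonal K * x ^ (3 * K) * T K \<approx> (- 1) ^ K * 1 * 1 * T 0"
    by (intro congr_mult congr_refl)
  from congr_trans[OF iter congr_add[OF congr_refl this]]
  have "T 0 \<approx> (\<Sum>k<K. (- 1) ^ k * q ^ pentagonal k * x ^ (3 * k) * (1 - q ^ (2 * k + 1) * x\<^sup>2)) - T 0"
    using \<open>odd K\<close> by simp
  from congr_add[OF this congr_refl[of "T 0"]] show ?thesis
    by (simp only: T_def mult_2 diff_add_cancel power_0 mult_1_left)
qed


section \<open>Differentiating the strange identity\<close>

text \<open>
  The polynomials with \<open>f(1 + \<epsilon>) = 0\<close> over the dual numbers of the quotient by \<open>I\<close>. Congruences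
  modulo this ideal may be differentiated at \<open>1\<close>.
\<close>

definition double_zero_ideal :: "'a :: idom set \<Rightarrow> 'a poly set" where
  "double_zero_ideal I = {f. poly f 1 \<in> I \<and> poly (pderiv f) 1 \<in> I}"

lemma ring_ideal_double_zero:
  assumes "ring_ideal I"
  shows "ring_ideal (double_zero_ideal I)"
proof -
  interpret ring_ideal I by fact
  have mult_mem': "a * c \<in> I" if "a \<in> I" for a c
    using mult_mem[OF that, of c] by (simp add: mult.commute)
  show ?thesis
    by unfold_locales
       (auto simp: double_zero_ideal_def zero_mem pderiv_add pderiv_mult
             intro!: add_mem intro: mult_mem mult_mem')
qed

text \<open>
  Each differentiation costs at most one factor: \<open>n\<close> factors whose values at \<open>1\<close> are divisible by
  \<open>y\<close> leave a derivative divisible by \<open>y ^ (n - 1)\<close>. The extra factor \<open>y\<close> in the second claim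
  avoids the truncated exponent in the induction.
\<close>

lemma power_dvd_poly_prod:
  fixes y :: "'a :: idom"
  assumes "\<And>i. i < n \<Longrightarrow> y dvd poly (f i) 1"
  shows "y ^ n dvd poly (\<Prod>i<n. f i) 1" "y ^ n dvd y * poly (pderiv (\<Prod>i<n. f i)) 1"
  using assms
proof (induction n)
  case (Suc n)
  { case 1
    then show ?case using Suc by (auto simp: poly_mult mult.commute[of y] intro!: mult_dvd_mono)
  next
    case 2
    have a: "y ^ n dvd poly (\<Prod>i<n. f i) 1" "y ^ n dvd y * poly (pderiv (\<Prod>i<n. f i)) 1"
      and b: "y dvd poly (f n) 1"
      using Suc 2 by auto
    have "y ^ n * y dvd (y * poly (pderiv (\<Prod>i<n. f i)) 1) * poly (f n) 1"
      by (intro mult_dvd_mono a b)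
    moreover have "y ^ n * y dvd poly (\<Prod>i<n. f i) 1 * (y * poly (pderiv (f n)) 1)"
      by (intro mult_dvd_mono a dvd_triv_left)
    ultimately show ?case
      by (simp add: pderiv_mult algebra_simps del: power_Suc) (simp add: algebra_simps dvd_add) }
qed simp_all

text \<open>
  Every summand of the polynomial has the factor \<open>1 - x\<close>, so only the derivative of this factor
  contributes at \<open>x = 1\<close>; it yields the partial sums of \<open>\<Sum>n. (q; q)\<^sub>n\<close>.
\<close>

lemma poly_zagier_sum:
  fixes q :: "'a :: idom"
  shows "poly (zagier_sum N [:q:] [:0, 1:]) 1 = 0"
    and "poly (pderiv (zagier_sum N [:q:] [:0, 1:])) 1 = - (\<Sum>n<N. \<Prod>i=1..n. 1 - q ^ i)"
proof -
  have e: "zagier_sum N [:q:] [:0, 1:] =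
      [:1, - 1:] * (\<Sum>n<N. qpoch [:0, q:] [:q:] n * [:0, 1:] ^ n)" (is "_ = _ * ?G")
  proof -
    have "1 - [:0, 1:] = [:1, - 1 :: 'a:]" "[:q:] * [:0, 1:] = [:0, q:]"
      by (simp_all add: one_pCons)
    then have "qpoch [:0, 1:] [:q:] (Suc n) * [:0, 1:] ^ n =
        [:1, - 1:] * (qpoch [:0, q:] [:q:] n * [:0, 1:] ^ n)" for n
      by (simp only: qpoch_Suc_left mult.assoc)
    then show ?thesis
      unfolding zagier_sum_def sum_distrib_left by (intro sum.cong refl)
  qed
  have "poly ?G 1 = (\<Sum>n<N. \<Prod>i=1..n. 1 - q ^ i)"
  proof -
    have "(\<Prod>i<n. 1 - q * q ^ i) = (\<Prod>i=1..n. 1 - q ^ i)" for n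
      by (rule prod.reindex_bij_witness[of _ "\<lambda>i. i - 1" Suc]) auto
    then show ?thesis by (simp add: poly_sum qpoch_def poly_prod)
  qed
  then show "poly (zagier_sum N [:q:] [:0, 1:]) 1 = 0"
    and "poly (pderiv (zagier_sum N [:q:] [:0, 1:])) 1 = - (\<Sum>n<N. \<Prod>i=1..n. 1 - q ^ i)"
    unfolding e pderiv_mult by (simp_all add: pderiv_pCons)
qed

text \<open>
  The congruence \<open>strange_identity\<close> for polynomials in \<open>x\<close>, modulo double zeros at \<open>x = 1\<close>. The
  assumption that \<open>K\<close> lies in \<open>I\<close> is what makes \<open>x ^ K\<close> congruent to \<open>1\<close>: the derivative of
  \<open>x ^ K - 1\<close> at \<open>1\<close> is \<open>K\<close>. The result is twice the derivative plus the value at \<open>1\<close>.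
\<close>

lemma strange_identity_derivative:
  fixes q y :: "'a :: idom"
  assumes I: "ring_ideal I"
    and y: "y \<noteq> 0" "y dvd 1 - q" "y ^ L \<in> I"
    and K: "q ^ K - 1 \<in> I" "of_nat K \<in> I" "odd K"
  shows "- 4 * (\<Sum>n\<le>L. \<Prod>i=1..n. 1 - q ^ i)
    - (\<Sum>k<K. (- 1) ^ k * (of_nat (6 * k + 1) * q ^ pentagonal k
                    - of_nat (6 * k + 5) * q ^ (pentagonal k + 2 * k + 1))) \<in> I"
proof -
  interpret ring_ideal I by fact
  interpret J: ring_ideal "double_zero_ideal I" by (rule ring_ideal_double_zero) fact
  let ?q = "[:q:]" and ?x = "[:0, 1:] :: 'a poly"
  define S where "S = zagier_sum (Suc L) ?q ?x"
  define G where "G = (\<Sum>k<K. (- 1) ^ k * ?q ^ pentagonal k * ?x ^ (3 * k) * (1 - ?q ^ (2 * k + 1) * ?x\<^sup>2))"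
  have in_I: "a \<in> I" if "y ^ L dvd a" for a
    using that y(3) mult_mem by (auto elim!: dvdE simp: mult.commute)
  have "2 * S - G \<in> double_zero_ideal I"
    unfolding S_def G_def J.congr_def[symmetric]
  proof (rule J.strange_identity)
    fix k
    have "y dvd poly (1 - ?q ^ k * ?x * ?q ^ i) 1" for i
    proof -
      have "1 - q dvd 1 - q ^ (k + i)"
        by (simp only: one_diff_power_eq dvd_triv_left)
      from dvd_trans[OF y(2) this] show ?thesis
        by (simp add: power_add poly_power)
    qed
    from power_dvd_poly_prod[of "Suc L" y "\<lambda>i. 1 - ?q ^ k * ?x * ?q ^ i", OF this] y(1)
    show "qpoch (?q ^ k * ?x) ?q (Suc L) \<in> double_zero_ideal I"
      unfolding double_zero_ideal_def qpoch_def
      by (auto intro!: in_I intro: dvd_trans[OF le_imp_power_dvd[of L "Suc L"]] simp del: prod.lessThan_Suc)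
  next
    show "J.congr (?q ^ K) 1"
      using K(1) unfolding J.congr_def unfolding double_zero_ideal_def
      by (simp add: poly_const_pow pderiv_diff pderiv_pCons zero_mem)
  next
    show "J.congr (?x ^ K) 1"
      using K(2) unfolding J.congr_def unfolding double_zero_ideal_def
      by (simp add: pderiv_diff pderiv_power pderiv_pCons zero_mem poly_power)
  qed (fact K(3))
  then have G0: "- poly G 1 \<in> I" and G1: "- 2 * (\<Sum>n\<le>L. \<Prod>i=1..n. 1 - q ^ i) - poly (pderiv G) 1 \<in> I"
    unfolding double_zero_ideal_def
    by (simp_all add: S_def poly_zagier_sum pderiv_diff pderiv_mult lessThan_Suc_atMost)
  have G: "G = (\<Sum>k<K. Polynomial.monom ((- 1) ^ k * q ^ pentagonal k) (3 * k)
                    - Polynomial.monom ((- 1) ^ k * q ^ (pentagonal k + 2 * k + 1)) (3 * k + 2))"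
    unfolding G_def
  proof (rule sum.cong)
    fix k
    have c: "?q ^ i = Polynomial.monom (q ^ i) 0" and x: "?x ^ i = Polynomial.monom 1 i" for i
      by (simp_all add: poly_const_pow monom_altdef)
    have "(- 1 :: 'a poly) ^ k = Polynomial.monom ((- 1) ^ k) 0"
      by (simp add: Polynomial.monom_0 one_pCons poly_const_pow)
    then show "(- 1) ^ k * ?q ^ pentagonal k * ?x ^ (3 * k) * (1 - ?q ^ (2 * k + 1) * ?x\<^sup>2) =
        Polynomial.monom ((- 1) ^ k * q ^ pentagonal k) (3 * k)
        - Polynomial.monom ((- 1) ^ k * q ^ (pentagonal k + 2 * k + 1)) (3 * k + 2)"
      unfolding c x right_diff_distrib by (simp add: Polynomial.mult_monom power_add mult_ac)
  qed simp
  have "poly G 1 = (\<Sum>k<K. (- 1) ^ k * (q ^ pentagonal k - q ^ (pentagonal k + 2 * k + 1)))"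
    unfolding G by (simp add: poly_sum poly_monom algebra_simps)
  moreover have "poly (pderiv G) 1 = (\<Sum>k<K. (- 1) ^ k * (of_nat (3 * k) * q ^ pentagonal k
                    - of_nat (3 * k + 2) * q ^ (pentagonal k + 2 * k + 1)))"
    unfolding G by (simp add: poly_sum poly_monom algebra_simps
        higher_pderiv_sum[of 1, simplified] pderiv_diff pderiv_monom)
  ultimately have "(\<Sum>k<K. (- 1) ^ k * (of_nat (6 * k + 1) * q ^ pentagonal k
                    - of_nat (6 * k + 5) * q ^ (pentagonal k + 2 * k + 1))) = 2 * poly (pderiv G) 1 + poly G 1"
    by (simp add: sum_distrib_left flip: sum.distrib) (simp add: algebra_simps)
  then have "- 4 * (\<Sum>n\<le>L. \<Prod>i=1..n. 1 - q ^ i)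
    - (\<Sum>k<K. (- 1) ^ k * (of_nat (6 * k + 1) * q ^ pentagonal k
                    - of_nat (6 * k + 5) * q ^ (pentagonal k + 2 * k + 1)))
    = 2 * (- 2 * (\<Sum>n\<le>L. \<Prod>i=1..n. 1 - q ^ i) - poly (pderiv G) 1) + - poly G 1"
    by (simp only:) (simp add: algebra_simps)
  then show ?thesis
    using add_mem[OF mult_mem[OF G1, of 2] G0] by (simp only:)
qed


section \<open>Coefficients of powers\<close>

text \<open>The derivative \<open>K * f ^ (K - 1) * f'\<close> of \<open>f ^ K\<close> is divisible by \<open>K\<close>.\<close>

lemma dvd_mult_nth_power:
  fixes f :: "'a :: comm_ring_1 fps"
  shows "of_nat K dvd of_nat k * fps_nth (f ^ K) k"
proof (cases k)
  case (Suc l)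
  have "of_nat k * fps_nth (f ^ K) k = fps_nth (fps_deriv (f ^ K)) l"
    using Suc by simp
  also have "\<dots> = of_nat K * fps_nth (fps_deriv f * f ^ (K - 1)) l"
    by (simp add: fps_deriv_power mult.assoc flip: fps_of_nat)
  finally show ?thesis by simp
qed simp

text \<open>
  A form of Frobenius: modulo \<open>p\<close>, a \<open>p ^ a\<close>-th power is a series in \<open>X ^ (p ^ a)\<close>. It is used
  with \<open>a = 1\<close>, and with large \<open>a\<close> to make \<open>Q ^ (p ^ a)\<close> congruent to its constant term.
\<close>

lemma prime_dvd_nth_prime_power:
  fixes f :: "int fps"
  assumes "prime p" "\<not> p ^ a dvd k"
  shows "int p dvd fps_nth (f ^ (p ^ a)) k"
proof (rule ccontr)
  assume "\<not> int p dvd fps_nth (f ^ (p ^ a)) k"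
  then have "coprime (int (p ^ a)) (fps_nth (f ^ (p ^ a)) k)"
    using assms(1) by (simp add: prime_imp_coprime)
  then have "int (p ^ a) dvd int k"
    using dvd_mult_nth_power[of "p ^ a" k f] by (simp add: coprime_dvd_mult_left_iff)
  then show False using assms(2) by presburger
qed

lemma one_minus_X_powi_diff:
  "one_minus_X_powi (int i - int j) = (1 - fps_X) ^ i * Abs_fps (\<lambda>_. 1) ^ j"
proof -
  have inverse: "(1 - fps_X) ^ d * Abs_fps (\<lambda>_. 1) ^ d = (1 :: int fps)" for d
    using geometric_series_inverse by (simp flip: power_mult_distrib)
  show ?thesis
  proof (cases "j \<le> i")
    case True
    then obtain d where "i = j + d" using le_Suc_ex by blast
    then show ?thesis
      using inverse[of j] by (simp add: one_minus_X_powi_def power_add mult_ac)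
  next
    case False
    then obtain d where "j = i + d" using le_Suc_ex nat_le_linear by blast
    then show ?thesis
      using inverse[of i] False by (simp add: one_minus_X_powi_def power_add flip: mult.assoc)
  qed
qed

lemma one_minus_X_powi_add:
  "one_minus_X_powi (a + b) = one_minus_X_powi a * one_minus_X_powi b"
proof -
  obtain i j k l where "a = int i - int j" "b = int k - int l"
    by (metis int_diff_cases)
  moreover from this have "a + b = int (i + k) - int (j + l)"
    by simp
  ultimately show ?thesis
    by (simp only: one_minus_X_powi_diff power_add mult_ac)
qed

lemma one_minus_X_powi_mult: "one_minus_X_powi (a * int n) = one_minus_X_powi a ^ n"
  by (induction n) (simp_all add: one_minus_X_powi_def[of 0] algebra_simps one_minus_X_powi_add)

lemma nth_one_minus_X_power_eq_0:
  assumes "j < (k :: nat)"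
  shows "fps_nth ((1 - fps_X :: int fps) ^ j) k = 0"
  using assms
  by (induction j arbitrary: k) (auto simp: algebra_simps)

text \<open>
  Split off the residue \<open>j\<close> of the exponent: \<open>(1 - X) ^ j\<close> has degree \<open>j < m\<close>, and the other factor
  is a \<open>p\<close>-th power, so modulo \<open>p\<close> its exponents are multiples of \<open>p\<close>.
\<close>

lemma prime_dvd_nth_one_minus_X_powi:
  assumes "prime p" "m < p" "a mod int p < int m"
  shows "int p dvd fps_nth (one_minus_X_powi a) (p * n + m)"
proof -
  define j where "j = nat (a mod int p)"
  define g where "g = one_minus_X_powi (a div int p) ^ p"
  have p: "p > 0" using assms(2) by simp
  have j: "j < m" "int j = a mod int p"
    using assms(3) p by (simp_all add: j_def nat_less_iff)
  have "a = int j + a div int p * int p"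
    using j by simp
  then have "one_minus_X_powi a = one_minus_X_powi (int j) * g"
    unfolding g_def by (metis one_minus_X_powi_add one_minus_X_powi_mult)
  then have a: "one_minus_X_powi a = (1 - fps_X) ^ j * g"
    by (simp add: one_minus_X_powi_def)
  have "int p dvd fps_nth ((1 - fps_X) ^ j) i * fps_nth g (p * n + m - i)" for i
  proof (cases "i \<le> j")
    case True
    then have "i < m" using j(1) by simp
    then have eq: "p * n + m - i = p * n + (m - i)" and "\<not> p dvd m - i"
      using assms(2) by (simp_all add: nat_dvd_not_less)
    then have "\<not> p dvd p * n + (m - i)"
      by (subst dvd_add_right_iff) auto
    then have "\<not> p ^ 1 dvd p * n + m - i"
      by (simp only: power_one_right eq not_False_eq_True)
    then have "int p dvd fps_nth g (p * n + m - i)"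
      using prime_dvd_nth_prime_power[OF assms(1), of 1] by (simp add: g_def)
    then show ?thesis by simp
  qed (simp add: nth_one_minus_X_power_eq_0)
  then show ?thesis
    unfolding a fps_mult_nth by (intro dvd_sum)
qed


section \<open>Fishburn numbers\<close>

text \<open>The ideal generated by \<open>p\<close> and \<open>X ^ L\<close>.\<close>

definition low_coeffs_dvd :: "nat \<Rightarrow> nat \<Rightarrow> int fps set" where
  "low_coeffs_dvd p L = {f. \<forall>k<L. int p dvd fps_nth f k}"

lemma ring_ideal_low_coeffs_dvd: "ring_ideal (low_coeffs_dvd p L)"
  by unfold_locales (auto simp: low_coeffs_dvd_def fps_mult_nth intro!: dvd_sum dvd_mult)

lemma fishburn_summand_altdef:
  "fishburn_summand r n = (\<Prod>i=1..n. 1 - one_minus_X_powi r ^ i)"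
  by (simp add: fishburn_summand_def one_minus_X_powi_mult)

text \<open>
  The coefficient \<open>a\<close> accounts for the residue class \<open>- r / 24\<close> that is left out of \<open>S\<^sup>*\<close>: as \<open>r\<close> is
  invertible modulo \<open>p\<close>, the exponent \<open>r * e\<close> is in this class only if \<open>p\<close> divides
  \<open>24 * e + 1 = a\<^sup>2\<close>. For an exponent outside this class
  it is the coefficient of the power itself that is divisible by \<open>p\<close>.
\<close>

lemma prime_dvd_pentagonal_term:
  fixes p m n e :: nat and r a k :: int
  assumes "prime p" "p \<ge> 5" "coprime r (int p)" "int m \<in> T_star p r 0"
    and k: "2 * int e = k * (3 * k - 1)" and a: "24 * int e + 1 = a\<^sup>2"
  shows "int p dvd a * fps_nth (one_minus_X_powi r ^ e) (p * n + m)"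
proof (cases "int p dvd a")
  case False
  define j where "j = (r * int e) mod int p"
  have "\<not> [24 * j = - r] (mod int p)"
  proof
    assume "[24 * j = - r] (mod int p)"
    then have "[24 * (r * int e) = - r] (mod int p)"
      unfolding j_def by (simp add: cong_def mod_mult_right_eq)
    then have "int p dvd r * a\<^sup>2"
      unfolding a[symmetric] by (simp add: cong_iff_dvd_diff algebra_simps)
    then have "int p dvd a\<^sup>2"
      using assms(3) by (simp add: coprime_dvd_mult_right_iff coprime_commute)
    then show False
      using False assms(1) prime_dvd_power by (metis prime_int_nat_transfer prime_nat_int_transfer)
  qed
  moreover have "r * (k * (3 * k - 1)) div 2 = r * int e"
    unfolding k[symmetric] by simp
  then have "[r * (k * (3 * k - 1)) div 2 = j - 0] (mod int p)"
    by (simp add: j_def cong_def)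
  moreover have "0 \<le> j" "j \<le> int p - 1"
    using assms(2) pos_mod_bound[of "int p" "r * int e"] by (auto simp: j_def)
  ultimately have "j \<in> S_star p r 0"
    unfolding S_star_def by auto
  then have "j < int m" "m < p"
    using assms(4) by (auto simp: T_star_def)
  then have "int p dvd fps_nth (one_minus_X_powi (r * int e)) (p * n + m)"
    unfolding j_def by (intro prime_dvd_nth_one_minus_X_powi assms)
  then show ?thesis by (simp add: one_minus_X_powi_mult)
qed simp

theorem corollary1p6:
  fixes p m n :: nat and r :: int
  assumes "prime p" and "p \<ge> 5" and "r \<noteq> 0" and "coprime r (int p)"
    and "int m \<in> T_star p r 0"
  shows "[fishburn r (p * n + m) = 0] (mod int p)"
proof -
  define N where "N = p * n + m"
  \<comment> \<open>A large power of \<open>p\<close>, for which \<open>Q ^ K - 1\<close> is divisible by \<open>X ^ K\<close> modulo \<open>p\<close>.\<close>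
  define K where "K = p ^ Suc N"
  let ?q = "one_minus_X_powi r" and ?I = "low_coeffs_dvd p (Suc N)"
  define R where "R = (\<Sum>k<K. (- 1) ^ k * (of_nat (6 * k + 1) * ?q ^ pentagonal k
                    - of_nat (6 * k + 5) * ?q ^ (pentagonal k + 2 * k + 1)))"
  have "- 4 * (\<Sum>i\<le>Suc N. fishburn_summand r i) - R \<in> ?I"
    unfolding R_def fishburn_summand_altdef
  proof (rule strange_identity_derivative)
    show "fps_X dvd 1 - ?q"
    proof (rule dvdI)
      show "1 - ?q = fps_X * fps_shift 1 (1 - ?q)"
        by (rule fps_ext) (auto simp: one_minus_X_powi_nth_0)
    qed
    show "fps_X ^ Suc N \<in> ?I"
      by (auto simp: low_coeffs_dvd_def fps_X_power_nth simp del: power_Suc)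
    have "int p dvd fps_nth (?q ^ K - 1) k" if "k < Suc N" for k
    proof (cases "k = 0")
      case False
      have "Suc N < p ^ Suc N"
        using assms(2) by (intro power_gt_expt) auto
      then have "\<not> p ^ Suc N dvd k"
        using False that by (intro nat_dvd_not_less) auto
      then show ?thesis
        using prime_dvd_nth_prime_power[OF assms(1), of "Suc N" k ?q] False by (simp add: K_def)
    qed (simp add: fps_power_zeroth one_minus_X_powi_nth_0)
    then show "?q ^ K - 1 \<in> ?I"
      by (simp add: low_coeffs_dvd_def)
    show "of_nat K \<in> ?I"
      by (auto simp: low_coeffs_dvd_def K_def fps_of_nat[symmetric] simp del: of_nat_power)
    show "odd K"
      using assms(1,2) prime_odd_nat[of p] by (simp add: K_def)
  qed (simp_all add: ring_ideal_low_coeffs_dvd)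
  then have "int p dvd fps_nth (- 4 * (\<Sum>i\<le>Suc N. fishburn_summand r i) - R) N"
    by (simp add: low_coeffs_dvd_def)
  moreover have "fps_nth (- 4 * (\<Sum>i\<le>Suc N. fishburn_summand r i)) N = - 4 * fishburn r N"
    by (simp add: numeral_fps_const fps_sum_nth fishburn_altdef fishburn_summand_nth_less)
  moreover have "int p dvd fps_nth R N"
  proof -
    have dvd1: "int p dvd (6 * int k + 1) * fps_nth (?q ^ pentagonal k) N" for k
      unfolding N_def
      by (rule prime_dvd_pentagonal_term) (fact assms pentagonal_int)+
    have dvd5: "int p dvd (6 * int k + 5) * fps_nth (?q ^ (pentagonal k + 2 * k + 1)) N" for k
      unfolding N_def
      by (rule prime_dvd_pentagonal_term) (fact assms pentagonal_int)+
    have "int p dvd fps_nth ((- 1) ^ k * (of_nat (6 * k + 1) * ?q ^ pentagonal k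
                    - of_nat (6 * k + 5) * ?q ^ (pentagonal k + 2 * k + 1))) N" for k
    proof -
      have scale: "fps_nth (of_nat c * f) N = int c * fps_nth f N" for c and f :: "int fps"
        by (simp flip: fps_of_nat)
      have sign: "fps_nth ((- 1) ^ k * f) N = (- 1) ^ k * fps_nth f N" for f :: "int fps"
        by (cases "even k") simp_all
      show ?thesis
        unfolding sign fps_sub_nth scale
        using dvd1[of k] dvd5[of k]
        by (intro dvd_mult[OF dvd_diff]) (simp_all only: of_nat_add of_nat_mult of_nat_numeral of_nat_1)
    qed
    then show ?thesis unfolding R_def fps_sum_nth by (intro dvd_sum)
  qed
  ultimately have "int p dvd 4 * fishburn r N"
    by (simp add: dvd_diff_left_iff)
  moreover have "\<not> int p dvd 4"
    using assms(2) zdvd_imp_le[of "int p" 4] by auto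
  ultimately show ?thesis
    using assms(1) by (simp add: N_def cong_0_iff prime_dvd_mult_iff)
qed

end
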